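(* Let $(G,p)$ be a (finite or infinite) bar-joint framework in $(\mathbb{R}^d,\|\cdot\|_{\mathcal{P}})$, where $\|\cdot\|_{\mathcal{P}}$ is a polyhedral norm, and let $(H,p)$ be a subframework of $(G,p)$. If for each pair of vertices $v,w\in V(H)$, $$\bigcap_{\gamma\in\Gamma_G(v,w)}X_\gamma=\{0\},$$ then $(H,p)$ is relatively infinitesimally rigid in $(G,p)$.
   Context: Let $d\ge 2$ and let $\mathcal{P}\subset\mathbb{R}^d$ be a convex symmetric ($\mathcal P=-\mathcal P$) $d$-dimensional polytope. The associated polyhedral norm is $\|x\|_{\mathcal{P}}=\inf\{\lambda\ge 0: x\in\lambda\mathcal{P}\}$. The polar set is $\mathcal{P}^\triangle=\{y\in\mathbb{R}^d: x\cdot y\le 1\ \forall x\in\mathcal{P}\}$. For each facet $F$ of $\mathcal{P}$, $\hat F$ is the unique extreme point of $\mathcal{P}^\triangle$ with $F=\{x\in\mathcal{P}: x\cdot\hat F=1\}$, $\varphi_F(x)=x\cdot\hat F$, and $\mathrm{cone}(F)$ is the set of all finite non-negative linear combinations of points of $F$. Write $[F]=\{F,-F\}$. A bar-joint framework $(G,p)$ consists of a simple undirected graph $G=(V(G),E(G))$ and a map $p:V(G)\to\mathbb{R}^d$ with $p_v\neq p_w$ whenever $vw\in E(G)$. A subframework $(H,p)$ is obtained by restricting $p$ to the vertex set of a subgraph $H$ of $G$. An infinitesimal flex of $(G,p)$ is a map $u:V(G)\to\mathbb{R}^d$ such that for each edge $vw$, $\|(p_v+tu_v)-(p_w+tu_w)\|_{\mathcal{P}}-\|p_v-p_w\|_{\mathcal{P}}=o(t)$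 as $t\to 0$; it is trivial if it is constant. $(H,p)$ is relatively infinitesimally rigid in $(G,p)$ if the restriction to $V(H)$ of every infinitesimal flex of $(G,p)$ is trivial (constant). For each edge $vw\in E(G)$ let $\Phi(vw)=\{[F]: F \text{ a facet of }\mathcal{P},\ p_v-p_w\in\mathrm{cone}(F)\cup\mathrm{cone}(-F)\}$ and $X_{vw}=\bigcap_{[F]\in\Phi(vw)}\ker\varphi_F\subseteq\mathbb{R}^d$ (well defined since $\varphi_{-F}=-\varphi_F$). For a path $\gamma=\{v_1v_2,v_2v_3,\ldots,v_{n-1}v_n\}$ in $G$ let $X_\gamma=X_{v_1v_2}+X_{v_2v_3}+\cdots+X_{v_{n-1}v_n}$. $\Gamma_G(v,w)$ denotes the set of all paths in $G$ from $v$ to $w$. *)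

theory Defs
  imports "HOL-Analysis.Analysis" "HOL-Library.Set_Algebras" "HOL-Library.Landau_Symbols"
begin

definition symmetric_polytope :: "(real ^ 'n) set \<Rightarrow> bool" where
  "symmetric_polytope P \<longleftrightarrow> polytope P \<and> uminus ` P = P \<and> aff_dim P = int CARD('n)"

definition polyhedral_norm :: "(real ^ 'n) set \<Rightarrow> real ^ 'n \<Rightarrow> real" where
  "polyhedral_norm P x = Inf {r. 0 \<le> r \<and> x \<in> (*\<^sub>R) r ` P}"

definition polar_set :: "(real ^ 'n) set \<Rightarrow> (real ^ 'n) set" where
  "polar_set P = {y. \<forall>x\<in>P. x \<bullet> y \<le> 1}"

text \<open>
  For a facet \<open>F\<close> of a symmetric polytope \<open>P\<close> of full dimension, the description below has
  exactly one solution, because \<open>0\<close> is an interior point of \<open>P\<close>.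
\<close>

definition facet_hat :: "(real ^ 'n) set \<Rightarrow> (real ^ 'n) set \<Rightarrow> real ^ 'n" where
  "facet_hat P F = (THE y. y extreme_point_of polar_set P \<and> F = {x \<in> P. x \<bullet> y = 1})"

definition facet_functional :: "(real ^ 'n) set \<Rightarrow> (real ^ 'n) set \<Rightarrow> real ^ 'n \<Rightarrow> real" where
  "facet_functional P F x = x \<bullet> facet_hat P F"

definition facet_cone :: "(real ^ 'n) set \<Rightarrow> (real ^ 'n) set" where
  "facet_cone F = {\<Sum>x\<in>S. c x *\<^sub>R x | S c. finite S \<and> S \<subseteq> F \<and> (\<forall>x\<in>S. 0 \<le> c x)}"

definition facet_pair :: "(real ^ 'n) set \<Rightarrow> (real ^ 'n) set set" where
  "facet_pair F = {F, uminus ` F}"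

record 'v ugraph =
  verts :: "'v set"
  edges :: "'v set set"

definition simple_graph :: "'v ugraph \<Rightarrow> bool" where
  "simple_graph G \<longleftrightarrow> (\<forall>e\<in>edges G. \<exists>v\<in>verts G. \<exists>w\<in>verts G. v \<noteq> w \<and> e = {v, w})"

definition subgraph_of :: "'v ugraph \<Rightarrow> 'v ugraph \<Rightarrow> bool" where
  "subgraph_of H G \<longleftrightarrow> simple_graph H \<and> verts H \<subseteq> verts G \<and> edges H \<subseteq> edges G"

text \<open>
  A placement is a total function on the type of vertices; only its values on the
  vertex set matter. The same holds for infinitesimal flexes. Accordingly, a subframework
  \<open>(H, p)\<close> of \<open>(G, p)\<close> is given by a subgraph \<open>H\<close> and the same function \<open>p\<close>.
\<close>

definition framework :: "'v ugraph \<Rightarrow> ('v \<Rightarrow> real ^ 'n) \<Rightarrow> bool" where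
  "framework G p \<longleftrightarrow> simple_graph G \<and> (\<forall>v w. {v, w} \<in> edges G \<longrightarrow> p v \<noteq> p w)"

definition infinitesimal_flex ::
    "(real ^ 'n) set \<Rightarrow> 'v ugraph \<Rightarrow> ('v \<Rightarrow> real ^ 'n) \<Rightarrow> ('v \<Rightarrow> real ^ 'n) \<Rightarrow> bool" where
  "infinitesimal_flex P G p u \<longleftrightarrow>
     (\<forall>v w. {v, w} \<in> edges G \<longrightarrow>
        (\<lambda>t. polyhedral_norm P ((p v + t *\<^sub>R u v) - (p w + t *\<^sub>R u w))
             - polyhedral_norm P (p v - p w)) \<in> o[at 0](\<lambda>t. t))"

definition trivial_on :: "'v set \<Rightarrow> ('v \<Rightarrow> real ^ 'n) \<Rightarrow> bool" where
  "trivial_on S u \<longleftrightarrow> (\<exists>c. \<forall>v\<in>S. u v = c)"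

definition relatively_infinitesimally_rigid ::
    "(real ^ 'n) set \<Rightarrow> 'v ugraph \<Rightarrow> 'v ugraph \<Rightarrow> ('v \<Rightarrow> real ^ 'n) \<Rightarrow> bool" where
  "relatively_infinitesimally_rigid P H G p \<longleftrightarrow>
     (\<forall>u. infinitesimal_flex P G p u \<longrightarrow> trivial_on (verts H) u)"

definition edge_colours ::
    "(real ^ 'n) set \<Rightarrow> ('v \<Rightarrow> real ^ 'n) \<Rightarrow> 'v \<Rightarrow> 'v \<Rightarrow> (real ^ 'n) set set set" where
  "edge_colours P p v w =
     {facet_pair F | F. F facet_of P \<and> p v - p w \<in> facet_cone F \<union> facet_cone (uminus ` F)}"

text \<open>
  The intersection runs over both representatives \<open>F\<close> and \<open>-F\<close> of each class. This is
  harmless, as their functionals differ only in sign.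
\<close>

definition edge_space ::
    "(real ^ 'n) set \<Rightarrow> ('v \<Rightarrow> real ^ 'n) \<Rightarrow> 'v \<Rightarrow> 'v \<Rightarrow> (real ^ 'n) set" where
  "edge_space P p v w =
     \<Inter> {{x. facet_functional P F x = 0} | F. F facet_of P \<and> facet_pair F \<in> edge_colours P p v w}"

text \<open>
  Paths are represented by their lists of vertices. For \<open>v = w\<close> the only path is the
  trivial one \<open>[v]\<close>, whose subspace is the empty sum \<open>{0}\<close>.
\<close>

definition graph_paths :: "'v ugraph \<Rightarrow> 'v \<Rightarrow> 'v \<Rightarrow> 'v list set" where
  "graph_paths G v w =
     {\<gamma>. \<gamma> \<noteq> [] \<and> hd \<gamma> = v \<and> last \<gamma> = w \<and> distinct \<gamma> \<and> set \<gamma> \<subseteq> verts G \<and>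
         (\<forall>i. Suc i < length \<gamma> \<longrightarrow> {\<gamma> ! i, \<gamma> ! Suc i} \<in> edges G)}"

text \<open>
  Addition of sets is the Minkowski sum of \<^theory>\<open>HOL-Library.Set_Algebras\<close>, whose
  neutral element is \<open>{0}\<close>.
\<close>

definition path_space ::
    "(real ^ 'n) set \<Rightarrow> ('v \<Rightarrow> real ^ 'n) \<Rightarrow> 'v list \<Rightarrow> (real ^ 'n) set" where
  "path_space P p \<gamma> = sum_list (map2 (edge_space P p) \<gamma> (tl \<gamma>))"

end

theory Submission
  imports Defs
begin

text \<open>
  For a facet \<open>F\<close> the functional \<open>\<phi>\<close> of \<open>F\<close> is bounded above by the norm and coincides with it
  on the cone of \<open>F\<close>. If \<open>u\<close> is a flex, \<open>vw\<close> an edge and \<open>p v - p w\<close> lies in that cone, then the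
  increment of the norm along \<open>t * (u v - u w)\<close> is at least \<open>t * \<phi> (u v - u w)\<close>; being \<open>o(t)\<close> for
  both signs of \<open>t\<close>, it forces \<open>\<phi> (u v - u w) = 0\<close>. Hence \<open>u v - u w\<close> lies in the space of the
  edge, and telescoping along a path puts \<open>u v - u w\<close> into the space of every path from \<open>v\<close>
  to \<open>w\<close>.
\<close>

section \<open>Facets and the extreme points of the polar set\<close>

lemma zero_in_interior_symmetric_polytope:
  fixes P :: "(real ^ 'n) set"
  assumes "symmetric_polytope P"
  shows "0 \<in> interior P"
proof -
  have P: "convex P" "uminus ` P = P" "aff_dim P = int CARD('n)"
    using assms polytope_imp_convex by (auto simp: symmetric_polytope_def)
  have "interior P \<noteq> {}"
    using P(3) interior_rel_interior_gen[of P] rel_interior_eq_empty[OF P(1)] aff_dim_empty[of P]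
    by (auto simp: DIM_cart)
  then obtain c where c: "c \<in> interior P" by blast
  have "- c \<in> interior (uminus ` P)"
    using c by (simp add: interior_negations)
  then have "- c \<in> interior P"
    by (simp add: P(2))
  \<comment> \<open>The origin is the midpoint of an interior point and its mirror image.\<close>
  then have "(1/2) *\<^sub>R c + (1/2) *\<^sub>R (- c) \<in> interior P"
    using c convex_interior[OF P(1)] by (intro convexD) auto
  then show ?thesis by simp
qed

text \<open>The hyperplane on which \<open>y\<close> takes the value 1 contains the affine hull of
  \<open>F\<close> and misses 0. So adjoining 0 raises the affine dimension by one, to the full
  dimension.\<close>

lemma span_facet_eq_UNIV:
  fixes P :: "(real ^ 'n) set"
  assumes "aff_dim P = int CARD('n)" "F facet_of P" "\<And>x. x \<in> F \<Longrightarrow> x \<bullet> y = 1"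
  shows "span F = UNIV"
proof -
  have "affine hull F \<subseteq> {x. y \<bullet> x = 1}"
    using assms(3) by (intro hull_minimal affine_hyperplane) (auto simp: inner_commute)
  then have "0 \<notin> affine hull F" by auto
  then have "aff_dim (insert 0 F) = int CARD('n)"
    using assms(1,2) by (simp add: aff_dim_insert facet_of_def)
  then have "dim (insert 0 F) = CARD('n)"
    using aff_dim_zero[of "insert 0 F"] hull_inc[of 0 "insert 0 F" affine] by simp
  then have "span (insert 0 F) = UNIV"
    using dim_eq_full[of "insert 0 F"] by (simp add: DIM_cart)
  then show ?thesis by simp
qed

lemma eq_if_inner_eq_on_spanning_set:
  fixes y z :: "'a::real_inner"
  assumes "span F = UNIV" "\<And>x. x \<in> F \<Longrightarrow> x \<bullet> y = x \<bullet> z"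
  shows "y = z"
proof -
  have "orthogonal (y - z) x" if "x \<in> F" for x
  proof -
    have "x \<bullet> (y - z) = 0"
      using assms(2)[OF that] unfolding inner_diff_right by simp
    then show ?thesis
      unfolding orthogonal_def by (subst inner_commute)
  qed
  moreover have "y - z \<in> span F"
    using assms(1) by simp
  ultimately have "orthogonal (y - z) (y - z)"
    by (rule orthogonal_to_span[rotated])
  then show ?thesis
    by (simp add: orthogonal_self)
qed

text \<open>Since \<open>facet_hat\<close> is a definite description, existence and uniqueness come
  first: the witness is a rescaled normal of a hyperplane exposing \<open>F\<close>, and it is
  unique because \<open>F\<close> spans the space.\<close>

lemma facet_hat:
  fixes P :: "(real ^ 'n) set"
  assumes P: "symmetric_polytope P" and F: "F facet_of P"
  shows "facet_hat P F \<in> polar_set P" and "F = {x \<in> P. x \<bullet> facet_hat P F = 1}"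
proof -
  let ?vertex = "\<lambda>y. y extreme_point_of polar_set P \<and> F = {x \<in> P. x \<bullet> y = 1}"
  have dimP: "aff_dim P = int CARD('n)" and polyhedron: "polyhedron P"
    using P by (auto simp: symmetric_polytope_def polytope_imp_polyhedron)
  have 0: "0 \<in> interior P"
    using P by (rule zero_in_interior_symmetric_polytope)
  have "F exposed_face_of P"
    using F exposed_face_of_polyhedron[OF polyhedron] facet_of_imp_face_of by blast
  then obtain a b where ab: "P \<subseteq> {x. a \<bullet> x \<le> b}" "F = P \<inter> {x. a \<bullet> x = b}"
    unfolding exposed_face_of_def by blast
  have "F \<noteq> P"
    using F by (auto simp: facet_of_irrefl)
  \<comment> \<open>With \<open>a = 0\<close>, the face \<open>F\<close> would be all of
    \<open>P\<close> if \<open>b = 0\<close> and empty otherwise; a facet is neither.\<close>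
  then have "a \<noteq> 0 \<or> b \<noteq> 0"
    using ab by auto
  then have a: "a \<noteq> 0"
    using ab F by (auto simp: facet_of_def)
  have "0 \<in> interior {x. a \<bullet> x \<le> b}"
    using 0 interior_mono[OF ab(1)] by blast
  then have b: "b > 0"
    using a by simp
  \<comment> \<open>Dividing by \<open>b > 0\<close> normalises the supporting inequality to
    right-hand side 1, as in the polar set.\<close>
  define y where "y = a /\<^sub>R b"
  have inner_y: "x \<bullet> y = (a \<bullet> x) / b" for x
    by (simp add: y_def inner_commute divide_inverse)
  have y: "y \<in> polar_set P" "F = {x \<in> P. x \<bullet> y = 1}"
    using ab b by (auto simp: polar_set_def inner_y)
  have span: "span F = UNIV"
    by (rule span_facet_eq_UNIV[OF dimP F, of y]) (use y in auto)
  \<comment> \<open>At a point of \<open>F\<close>, the values of \<open>c\<close> and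
    \<open>d\<close> are at most 1 and have a weighted mean of 1 with positive weights, so both are
    1. Hence \<open>c\<close> and \<open>d\<close> agree on a spanning set.\<close>
  have "y \<notin> open_segment c d" if cd: "c \<in> polar_set P" "d \<in> polar_set P" for c d
  proof
    assume "y \<in> open_segment c d"
    then obtain t where t: "c \<noteq> d" "0 < t" "t < 1" "y = (1 - t) *\<^sub>R c + t *\<^sub>R d"
      by (auto simp: in_segment)
    have "x \<bullet> c = x \<bullet> d" if "x \<in> F" for x
    proof -
      have *: "(1 - t) * (1 - x \<bullet> c) + t * (1 - x \<bullet> d) = 0"
        using that y(2) t(4) by (auto simp: inner_add_right algebra_simps)
      have "x \<bullet> c \<le> 1" "x \<bullet> d \<le> 1"
        using that y(2) cd by (auto simp: polar_set_def)
      then have "(1 - t) * (1 - x \<bullet> c) = 0" "t * (1 - x \<bullet> d) = 0"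
        using * t by (simp_all add: add_nonneg_eq_0_iff)
      then show ?thesis using t by simp
    qed
    then have "c = d"
      by (rule eq_if_inner_eq_on_spanning_set[OF span])
    with t(1) show False by simp
  qed
  then have "?vertex y"
    using y by (auto simp: extreme_point_of_def)
  moreover have "z = y" if "?vertex z" for z
  proof (rule eq_if_inner_eq_on_spanning_set[OF span])
    show "x \<bullet> z = x \<bullet> y" if "x \<in> F" for x
      using that y(2) \<open>?vertex z\<close> by fastforce
  qed
  ultimately have "?vertex (facet_hat P F)"
    unfolding facet_hat_def by (rule theI)
  then show "facet_hat P F \<in> polar_set P" "F = {x \<in> P. x \<bullet> facet_hat P F = 1}"
    by (auto simp: extreme_point_of_def)
qed

section \<open>The polyhedral norm compared with linear functionals\<close>

lemma inner_le_polyhedral_norm: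
  fixes P :: "(real ^ 'n) set"
  assumes "0 \<in> interior P" "y \<in> polar_set P"
  shows "x \<bullet> y \<le> polyhedral_norm P x"
  unfolding polyhedral_norm_def
proof (rule cInf_greatest)
  obtain e where e: "e > 0" "cball 0 e \<subseteq> P"
    using assms(1) mem_interior_cball by blast
  \<comment> \<open>An infimum over the empty set would carry no information, so an admissible
    factor is exhibited; the summand 1 keeps it positive at \<open>x = 0\<close>.\<close>
  have "x \<in> (*\<^sub>R) ((norm x + 1) / e) ` P"
  proof (rule image_eqI)
    have "norm x + 1 > 0"
      by (simp add: add_nonneg_pos)
    then show "x = ((norm x + 1) / e) *\<^sub>R ((e / (norm x + 1)) *\<^sub>R x)"
      using e(1) by simp
    have "(e / (norm x + 1)) *\<^sub>R x \<in> cball 0 e"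
      using e(1) \<open>norm x + 1 > 0\<close> by (simp add: field_simps)
    then show "(e / (norm x + 1)) *\<^sub>R x \<in> P"
      using e(2) by blast
  qed
  then show "{r. 0 \<le> r \<and> x \<in> (*\<^sub>R) r ` P} \<noteq> {}"
    using e(1) by (auto intro!: exI[of _ "(norm x + 1) / e"])
next
  fix r assume "r \<in> {r. 0 \<le> r \<and> x \<in> (*\<^sub>R) r ` P}"
  then obtain q where q: "0 \<le> r" "q \<in> P" "x = r *\<^sub>R q" by auto
  then have "r * (q \<bullet> y) \<le> r * 1"
    using assms(2) by (intro mult_left_mono) (auto simp: polar_set_def)
  then show "x \<bullet> y \<le> r"
    using q by simp
qed

text \<open>Since \<open>y\<close> is 1 on \<open>F\<close>, the coefficients of a conic combination
  \<open>x\<close> add up to \<open>x \<bullet> y\<close>; dividing by this sum gives a convex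
  combination, so \<open>x\<close> lies in that multiple of \<open>P\<close>.\<close>

lemma polyhedral_norm_le_inner:
  fixes P :: "(real ^ 'n) set"
  assumes "convex P" "0 \<in> P" "F \<subseteq> P" "\<And>x. x \<in> F \<Longrightarrow> x \<bullet> y = 1" "x \<in> facet_cone F"
  shows "polyhedral_norm P x \<le> x \<bullet> y"
proof -
  obtain S c where S: "finite S" "S \<subseteq> F" "\<forall>q\<in>S. 0 \<le> c q" "x = (\<Sum>q\<in>S. c q *\<^sub>R q)"
    using assms(5) by (auto simp: facet_cone_def)
  have "x \<bullet> y = (\<Sum>q\<in>S. c q * (q \<bullet> y))"
    by (simp add: S(4) inner_sum_left)
  also have "\<dots> = sum c S"
    using S(2) assms(4) by (intro sum.cong) auto
  finally have xy: "x \<bullet> y = sum c S" .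
  have "x \<in> (*\<^sub>R) (sum c S) ` P"
  proof (cases "sum c S = 0")
    case True
    then have "x = 0"
      using S by (simp add: sum_nonneg_eq_0_iff)
    with True assms(2) show ?thesis by auto
  next
    case False
    have "(\<Sum>q\<in>S. (c q / sum c S) *\<^sub>R q) \<in> P"
    proof (rule convex_sum[OF S(1) assms(1)])
      show "(\<Sum>q\<in>S. c q / sum c S) = 1"
        using False by (simp flip: sum_divide_distrib)
      show "0 \<le> c q / sum c S" if "q \<in> S" for q
        using that S(3) by (simp add: sum_nonneg)
      show "q \<in> P" if "q \<in> S" for q
        using that S(2) assms(3) by blast
    qed
    moreover have "x = sum c S *\<^sub>R (\<Sum>q\<in>S. (c q / sum c S) *\<^sub>R q)"
      using False by (simp add: S(4) scaleR_sum_right)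
    ultimately show ?thesis by blast
  qed
  then show ?thesis
    unfolding polyhedral_norm_def xy using S(3)
    by (intro cInf_lower bdd_belowI[of _ 0]) (auto simp: sum_nonneg)
qed

section \<open>First-order consequences of a vanishing norm increment\<close>

lemma linear_minorant_of_smallo_eq_0:
  fixes f :: "real \<Rightarrow> real"
  assumes "f \<in> o[at 0](\<lambda>t. t)" "\<And>t. t * a \<le> f t"
  shows "a = 0"
proof (rule ccontr)
  assume a: "a \<noteq> 0"
  then have "\<forall>\<^sub>F t in at 0. norm (f t) \<le> \<bar>a\<bar> / 2 * norm t"
    using landau_o.smallD[OF assms(1), of "\<bar>a\<bar> / 2"] by simp
  then obtain e where e: "e > 0" "\<And>t. t \<noteq> 0 \<Longrightarrow> \<bar>t\<bar> < e \<Longrightarrow> \<bar>f t\<bar> \<le> \<bar>a\<bar> / 2 * \<bar>t\<bar>"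
    by (auto simp: eventually_at)
  \<comment> \<open>The sign of \<open>t\<close> makes the minorant positive, and then it exceeds
    the bound with slope \<open>\<bar>a\<bar> / 2\<close>.\<close>
  define t where "t = e / 2 * sgn a"
  have t: "t \<noteq> 0" "\<bar>t\<bar> < e" "t * a = \<bar>t\<bar> * \<bar>a\<bar>"
    using a e(1) by (auto simp: t_def sgn_if abs_mult)
  have "\<bar>t\<bar> * \<bar>a\<bar> \<le> \<bar>f t\<bar>"
    using assms(2)[of t] t(3) by linarith
  also have "\<dots> \<le> \<bar>t\<bar> * \<bar>a\<bar> / 2"
    using e(2)[OF t(1,2)] by (simp add: mult.commute[of "\<bar>a\<bar>"])
  finally have "\<bar>t\<bar> * \<bar>a\<bar> \<le> 0" by linarith
  moreover have "\<bar>t\<bar> * \<bar>a\<bar> > 0"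
    using t(1) a by simp
  ultimately show False by linarith
qed

lemma inner_eq_0_if_norm_increment_smallo:
  fixes P :: "(real ^ 'n) set"
  assumes "0 \<in> interior P" "y \<in> polar_set P" "polyhedral_norm P x \<le> x \<bullet> y"
    and "(\<lambda>t. polyhedral_norm P (x + t *\<^sub>R z) - polyhedral_norm P x) \<in> o[at 0](\<lambda>t. t)"
  shows "z \<bullet> y = 0"
proof (rule linear_minorant_of_smallo_eq_0[OF assms(4)])
  fix t
  show "t * (z \<bullet> y) \<le> polyhedral_norm P (x + t *\<^sub>R z) - polyhedral_norm P x"
    using inner_le_polyhedral_norm[OF assms(1,2), of "x + t *\<^sub>R z"] assms(3)
    by (simp add: inner_add_left)
qed

lemma facet_functional_eq_0_if_norm_increment_smallo:
  fixes P :: "(real ^ 'n) set"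
  assumes P: "symmetric_polytope P" and F: "F facet_of P"
    and x: "x \<in> facet_cone F \<union> facet_cone (uminus ` F)"
    and small: "(\<lambda>t. polyhedral_norm P (x + t *\<^sub>R z) - polyhedral_norm P x) \<in> o[at 0](\<lambda>t. t)"
  shows "facet_functional P F z = 0"
proof -
  let ?y = "facet_hat P F"
  have 0: "0 \<in> interior P"
    using P by (rule zero_in_interior_symmetric_polytope)
  then have zero: "0 \<in> P"
    using interior_subset by blast
  have convex: "convex P" and sym: "uminus ` P = P"
    using P polytope_imp_convex by (auto simp: symmetric_polytope_def)
  have y: "?y \<in> polar_set P" "F \<subseteq> P" "\<And>q. q \<in> F \<Longrightarrow> q \<bullet> ?y = 1"
    using facet_hat[OF P F] by auto
  \<comment> \<open>By symmetry \<open>- ?y\<close> serves the opposite cone directly, and it has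
    the same kernel as \<open>?y\<close>.\<close>
  have y': "- ?y \<in> polar_set P" "uminus ` F \<subseteq> P" "\<And>q. q \<in> uminus ` F \<Longrightarrow> q \<bullet> (- ?y) = 1"
  proof -
    show "uminus ` F \<subseteq> P"
      using y(2) sym by blast
    show "q \<bullet> (- ?y) = 1" if "q \<in> uminus ` F" for q
      using that y(3) by auto
    have "- q \<in> P" if "q \<in> P" for q
      using that sym by blast
    then have "(- q) \<bullet> ?y \<le> 1" if "q \<in> P" for q
      using that y(1) unfolding polar_set_def by blast
    then show "- ?y \<in> polar_set P"
      by (simp add: polar_set_def)
  qed
  from x show ?thesis
  proof
    assume "x \<in> facet_cone F"
    then have "z \<bullet> ?y = 0"
      by (intro inner_eq_0_if_norm_increment_smallo[OF 0 y(1) _ small]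
          polyhedral_norm_le_inner[OF convex zero y(2,3)])
    then show ?thesis by (simp add: facet_functional_def)
  next
    assume "x \<in> facet_cone (uminus ` F)"
    then have "z \<bullet> (- ?y) = 0"
      by (intro inner_eq_0_if_norm_increment_smallo[OF 0 y'(1) _ small]
          polyhedral_norm_le_inner[OF convex zero y'(2,3)])
    then show ?thesis by (simp add: facet_functional_def)
  qed
qed

section \<open>From edges to paths\<close>

lemma flex_difference_in_edge_space:
  fixes P :: "(real ^ 'n) set"
  assumes P: "symmetric_polytope P" and u: "infinitesimal_flex P G p u" and vw: "{v, w} \<in> edges G"
  shows "u v - u w \<in> edge_space P p v w"
proof -
  let ?x = "p v - p w" and ?z = "u v - u w"
  have eq: "(p v + t *\<^sub>R u v) - (p w + t *\<^sub>R u w) = ?x + t *\<^sub>R ?z" for t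
    by (simp add: algebra_simps)
  have small: "(\<lambda>t. polyhedral_norm P (?x + t *\<^sub>R ?z) - polyhedral_norm P ?x) \<in> o[at 0](\<lambda>t. t)"
    using u[unfolded infinitesimal_flex_def, rule_format, OF vw] unfolding eq .
  have "facet_functional P F ?z = 0"
    if F: "F facet_of P" and colour: "facet_pair F \<in> edge_colours P p v w" for F
  proof -
    \<comment> \<open>The facet witnessing the colour may be the opposite of \<open>F\<close>, but
      the union of the two cones does not depend on the representative.\<close>
    obtain F' where F': "{F, uminus ` F} = {F', uminus ` F'}"
      "?x \<in> facet_cone F' \<union> facet_cone (uminus ` F')"
      using colour by (auto simp: edge_colours_def facet_pair_def)
    from F'(1) consider "F = F'" | "F = uminus ` F'" "uminus ` F = F'"
      unfolding doubleton_eq_iff by blast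
    then have "?x \<in> facet_cone F \<union> facet_cone (uminus ` F)"
      using F'(2) by cases (simp_all add: image_image Un_commute)
    then show ?thesis
      by (rule facet_functional_eq_0_if_norm_increment_smallo[OF P F _ small])
  qed
  then show ?thesis
    by (auto simp: edge_space_def)
qed

text \<open>Pairing a list with its tail lists the consecutive pairs. A one-vertex list leaves the
  empty sum, the set containing only 0, which matches a zero difference.\<close>

lemma telescope_in_sum_list:
  fixes f :: "'v \<Rightarrow> 'a::ab_group_add"
  assumes "successively (\<lambda>v w. f v - f w \<in> X v w) \<gamma>" "\<gamma> \<noteq> []"
  shows "f (hd \<gamma>) - f (last \<gamma>) \<in> sum_list (map2 X \<gamma> (tl \<gamma>))"
  using assms
proof (induction \<gamma> rule: induct_list012)
  case (3 v w \<gamma>)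
  then have "(f v - f w) + (f w - f (last (w # \<gamma>))) \<in> X v w + sum_list (map2 X (w # \<gamma>) \<gamma>)"
    by (intro set_plus_intro) auto
  then show ?case by simp
qed auto

theorem proposition3p5:
  fixes P :: "(real ^ 'n) set"
    and G H :: "'v ugraph"
    and p :: "'v \<Rightarrow> real ^ 'n"
  assumes "CARD('n) \<ge> 2"
    and "symmetric_polytope P"
    and "framework G p"
    and "subgraph_of H G"
    and "\<And>v w. v \<in> verts H \<Longrightarrow> w \<in> verts H \<Longrightarrow>
           (\<Inter>\<gamma>\<in>graph_paths G v w. path_space P p \<gamma>) = {0}"
  shows "relatively_infinitesimally_rigid P H G p"
  unfolding relatively_infinitesimally_rigid_def
proof (intro allI impI)
  fix u
  assume u: "infinitesimal_flex P G p u"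
  have path: "u v - u w \<in> path_space P p \<gamma>" if "\<gamma> \<in> graph_paths G v w" for v w \<gamma>
  proof -
    have \<gamma>: "\<gamma> \<noteq> []" "hd \<gamma> = v" "last \<gamma> = w"
      "\<And>i. Suc i < length \<gamma> \<Longrightarrow> {\<gamma> ! i, \<gamma> ! Suc i} \<in> edges G"
      using that by (auto simp: graph_paths_def)
    have "successively (\<lambda>v w. u v - u w \<in> edge_space P p v w) \<gamma>"
      using \<gamma>(4) flex_difference_in_edge_space[OF assms(2) u] by (simp add: successively_conv_nth)
    then have "u (hd \<gamma>) - u (last \<gamma>) \<in> path_space P p \<gamma>"
      unfolding path_space_def using \<gamma>(1) by (rule telescope_in_sum_list)
    then show ?thesis
      unfolding \<gamma>(2,3) .
  qed
  have "u v = u w" if "v \<in> verts H" "w \<in> verts H" for v w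
  proof -
    \<comment> \<open>Without a path from \<open>v\<close> to \<open>w\<close> this intersection
      would be the whole space, a case that the hypothesis excludes.\<close>
    have "u v - u w \<in> (\<Inter>\<gamma>\<in>graph_paths G v w. path_space P p \<gamma>)"
      using path by (rule INT_I)
    then show ?thesis
      unfolding assms(5)[OF that] by simp
  qed
  then show "trivial_on (verts H) u"
    unfolding trivial_on_def by metis
qed

end
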